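(* Let $(X,d)$ be a compact metric space, let $f_0,\dots,f_{m-1}$ be continuous transformations of $X$ to itself, and let $\varphi\in C(X,\mathbb{R})$. Then $$\lim_{r\to 0}P_r(f_0,f_1,\dots,f_{m-1},\varphi)=P(f_0,f_1,\dots,f_{m-1},\varphi),$$ where $P(f_0,\dots,f_{m-1},\varphi)$ is the topological pressure and $P_r(f_0,\dots,f_{m-1},\varphi)$, $0<r<1$, is the topological $r$-pressure of the free semigroup action generated by $f_0,\dots,f_{m-1}$.
   Context: Here $m\ge 1$ is an integer and $F_m^+$ is the set of finite words in the symbols $0,1,\dots,m-1$; $|w|$ is the length of $w$. For $w=w_k\cdots w_1$ put $f_w=f_{w_k}\circ\cdots\circ f_{w_1}$, with $f_\emptyset=\mathrm{id}$ for the empty word. The relation $w'\le w$ means that $w=w''w'$ for some word $w''$; when $w'\le w$ is used as an index for $w=w_k\cdots w_1$, $w'$ ranges over the $k=|w|$ words $\emptyset,\ w_1,\ w_2w_1,\ \dots,\ w_{k-1}\cdots w_1$. Put $(S_w\varphi)(x)=\sum_{w'\le w}\varphi(f_{w'}x)$ and $d_w(x,y)=\max_{w'\le w}d(f_{w'}x,f_{w'}y)$. Topological pressure: for $\varepsilon>0$, $F\subset X$ is a $(w,\varepsilon,f_0,\dots,f_{m-1})$-spanning set of $X$ if for every $x\in X$ there is $y\in F$ with $d_w(x,y)\le\varepsilon$. Let $Q_w(f_0,\dots,f_{m-1},\varphi,\varepsilon)=\inf\{\sum_{x\in F}e^{(S_w\varphi)(x)}: F \text{ is a } (w,\varepsilon,f_0,\dots,f_{m-1})\text{-spanning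 set of }X\}$, $Q_n(f_0,\dots,f_{m-1},\varphi,\varepsilon)=\frac1{m^n}\sum_{|w|=n}Q_w(f_0,\dots,f_{m-1},\varphi,\varepsilon)$, and $$P(f_0,\dots,f_{m-1},\varphi)=\lim_{\varepsilon\to0}\limsup_{n\to\infty}\tfrac1n\log Q_n(f_0,\dots,f_{m-1},\varphi,\varepsilon).$$ Topological $r$-pressure: for $0<r<1$, $\varepsilon>0$, $x\in X$, let $$B(x,w,\varepsilon,r,f_0,\dots,f_{m-1})=\Big\{y\in X:\tfrac1{|w|}\mathrm{Card}\{w'\le w: d(f_{w'}x,f_{w'}y)<\varepsilon\}>1-r\Big\}.$$ $F\subset X$ is a $(w,\varepsilon,r,f_0,\dots,f_{m-1})$-spanning set of $X$ if for every $x\in X$ there is $y\in F$ with $x\in B(y,w,\varepsilon,r,f_0,\dots,f_{m-1})$. Let $Q_w(f_0,\dots,f_{m-1},\varphi,\varepsilon,r)=\inf\{\sum_{x\in F}e^{(S_w\varphi)(x)}: F \text{ is a } (w,\varepsilon,r,f_0,\dots,f_{m-1})\text{-spanning set of }X\}$, $Q_n(f_0,\dots,f_{m-1},\varphi,\varepsilon,r)=\frac1{m^n}\sum_{|w|=n}Q_w(f_0,\dots,f_{m-1},\varphi,\varepsilon,r)$, and $$P_r(f_0,\dots,f_{m-1},\varphi)=\lim_{\varepsilon\to0}\limsup_{n\to\infty}\tfrac1n\log Q_n(f_0,\dots,f_{m-1},\varphi,\varepsilon,r).$$ Values are in the extended reals; limits $\varepsilon\to0$ and $r\to0$ are from above.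 *)

theory Defs
  imports "HOL-Analysis.Analysis" "HOL-Library.Sublist"
begin

(* A word w_k ... w_1 is the list [w_k, ..., w_1].  Then w' \<le> w is suffix w' w, and
   f_w = f_{w_k} o ... o f_{w_1} acts on x as foldr f w x, the last letter first.
   As an index of sums, maxima and counts, w' \<le> w ranges only over the |w| proper
   suffixes of w. *)

definition words :: "nat \<Rightarrow> nat \<Rightarrow> nat list set" where
  "words m n = {w. set w \<subseteq> {..<m} \<and> length w = n}"

definition word_map :: "(nat \<Rightarrow> 'a \<Rightarrow> 'a) \<Rightarrow> nat list \<Rightarrow> 'a \<Rightarrow> 'a" where
  "word_map f w = foldr f w"

definition initial_words :: "nat list \<Rightarrow> nat list set" where
  "initial_words w = {w'. strict_suffix w' w}"

definition birkhoff_sum :: "(nat \<Rightarrow> 'a \<Rightarrow> 'a) \<Rightarrow> ('a \<Rightarrow> real) \<Rightarrow> nat list \<Rightarrow> 'a \<Rightarrow> real" where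
  "birkhoff_sum f \<phi> w x = (\<Sum>w'\<in>initial_words w. \<phi> (word_map f w' x))"

(* Unspecified for the empty word, where the index set is empty; this only affects the
   n = 0 term of the upper limits below. *)
definition word_dist ::
  "(nat \<Rightarrow> 'a::metric_space \<Rightarrow> 'a) \<Rightarrow> nat list \<Rightarrow> 'a \<Rightarrow> 'a \<Rightarrow> real" where
  "word_dist f w x y = (MAX w'\<in>initial_words w. dist (word_map f w' x) (word_map f w' y))"

definition spanning ::
  "'a::metric_space set \<Rightarrow> (nat \<Rightarrow> 'a \<Rightarrow> 'a) \<Rightarrow> nat list \<Rightarrow> real \<Rightarrow> 'a set \<Rightarrow> bool" where
  "spanning X f w \<epsilon> F \<longleftrightarrow> F \<subseteq> X \<and> (\<forall>x\<in>X. \<exists>y\<in>F. word_dist f w x y \<le> \<epsilon>)"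

definition r_ball ::
  "'a::metric_space set \<Rightarrow> (nat \<Rightarrow> 'a \<Rightarrow> 'a) \<Rightarrow> 'a \<Rightarrow> nat list \<Rightarrow> real \<Rightarrow> real \<Rightarrow> 'a set" where
  "r_ball X f x w \<epsilon> r =
    {y \<in> X. 1 / real (length w) *
        real (card {w' \<in> initial_words w. dist (word_map f w' x) (word_map f w' y) < \<epsilon>}) > 1 - r}"

definition r_spanning ::
  "'a::metric_space set \<Rightarrow> (nat \<Rightarrow> 'a \<Rightarrow> 'a) \<Rightarrow> nat list \<Rightarrow> real \<Rightarrow> real \<Rightarrow> 'a set \<Rightarrow> bool" where
  "r_spanning X f w \<epsilon> r F \<longleftrightarrow> F \<subseteq> X \<and> (\<forall>x\<in>X. \<exists>y\<in>F. x \<in> r_ball X f y w \<epsilon> r)"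

(* Spanning sets may be infinite, so the weight is an unordered sum in [0,\<infinity>]; a finite
   sum over an infinite set would be 0 by convention and spoil the infimum. *)
definition weight ::
  "(nat \<Rightarrow> 'a \<Rightarrow> 'a) \<Rightarrow> ('a \<Rightarrow> real) \<Rightarrow> nat list \<Rightarrow> 'a set \<Rightarrow> ennreal" where
  "weight f \<phi> w F = (\<Sum>\<^sub>\<infinity>x\<in>F. ennreal (exp (birkhoff_sum f \<phi> w x)))"

definition Q_word ::
  "'a::metric_space set \<Rightarrow> (nat \<Rightarrow> 'a \<Rightarrow> 'a) \<Rightarrow> ('a \<Rightarrow> real) \<Rightarrow> real \<Rightarrow> nat list \<Rightarrow> ennreal" where
  "Q_word X f \<phi> \<epsilon> w = (INF F\<in>{F. spanning X f w \<epsilon> F}. weight f \<phi> w F)"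

definition Q_word_r ::
  "'a::metric_space set \<Rightarrow> (nat \<Rightarrow> 'a \<Rightarrow> 'a) \<Rightarrow> ('a \<Rightarrow> real) \<Rightarrow> real \<Rightarrow> real \<Rightarrow> nat list \<Rightarrow> ennreal" where
  "Q_word_r X f \<phi> \<epsilon> r w = (INF F\<in>{F. r_spanning X f w \<epsilon> r F}. weight f \<phi> w F)"

definition Q_avg ::
  "'a::metric_space set \<Rightarrow> nat \<Rightarrow> (nat \<Rightarrow> 'a \<Rightarrow> 'a) \<Rightarrow> ('a \<Rightarrow> real) \<Rightarrow> real \<Rightarrow> nat \<Rightarrow> ennreal" where
  "Q_avg X m f \<phi> \<epsilon> n = (\<Sum>w\<in>words m n. Q_word X f \<phi> \<epsilon> w) / of_nat (m ^ n)"

definition Q_avg_r ::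
  "'a::metric_space set \<Rightarrow> nat \<Rightarrow> (nat \<Rightarrow> 'a \<Rightarrow> 'a) \<Rightarrow> ('a \<Rightarrow> real) \<Rightarrow> real \<Rightarrow> real \<Rightarrow> nat \<Rightarrow> ennreal" where
  "Q_avg_r X m f \<phi> \<epsilon> r n = (\<Sum>w\<in>words m n. Q_word_r X f \<phi> \<epsilon> r w) / of_nat (m ^ n)"

(* Logarithm from [0,\<infinity>] to [-\<infinity>,\<infinity>]; the value 0 occurs when X is empty. *)
definition ext_ln :: "ennreal \<Rightarrow> ereal" where
  "ext_ln q = (if q = 0 then -\<infinity> else if q = top then \<infinity> else ereal (ln (enn2real q)))"

definition pressure ::
  "'a::metric_space set \<Rightarrow> nat \<Rightarrow> (nat \<Rightarrow> 'a \<Rightarrow> 'a) \<Rightarrow> ('a \<Rightarrow> real) \<Rightarrow> ereal" where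
  "pressure X m f \<phi> =
    Lim (at_right 0) (\<lambda>\<epsilon>. limsup (\<lambda>n. ereal (1 / real n) * ext_ln (Q_avg X m f \<phi> \<epsilon> n)))"

definition r_pressure ::
  "'a::metric_space set \<Rightarrow> nat \<Rightarrow> (nat \<Rightarrow> 'a \<Rightarrow> 'a) \<Rightarrow> ('a \<Rightarrow> real) \<Rightarrow> real \<Rightarrow> ereal" where
  "r_pressure X m f \<phi> r =
    Lim (at_right 0) (\<lambda>\<epsilon>. limsup (\<lambda>n. ereal (1 / real n) * ext_ln (Q_avg_r X m f \<phi> \<epsilon> r n)))"

end

theory Submission
  imports Defs "HOL-Real_Asymp.Real_Asymp"
begin

text \<open>
  Since \<open>d\<^sub>w\<close>-closeness is closeness at every initial word, a spanning set is r-spanning at any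
  larger scale, and the r-pressure never exceeds the pressure. The content is the reverse
  inequality up to an error that vanishes with \<open>r\<close>.

  Let \<open>F\<close> be r-spanning at scale \<open>\<delta>\<close> for a word of length \<open>n\<close>, and let \<open>E\<close> be a finite
  \<open>\<delta>\<close>-net of \<open>X\<close>. The orbit of a point \<open>x\<close> follows that of some \<open>y \<in> F\<close> except at fewer than
  \<open>r n\<close> initial words, and at each exception it is \<open>\<delta>\<close>-close to a point of \<open>E\<close>. Record this as
  a pattern \<open>h\<close>, where \<open>h v = None\<close> means that \<open>x\<close> follows \<open>y\<close> at \<open>v\<close> and \<open>h v = Some e\<close> that it is
  near \<open>e\<close>. Two points with the same \<open>y\<close> and \<open>h\<close> are within \<open>2 \<delta>\<close> of each other at all initial
  words, so choosing one point for each realised pair gives a spanning set at scale \<open>2 \<delta>\<close>.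

  Its weight is controlled by a generating function. Let \<open>\<phi>\<close> vary by at most \<open>\<eta>\<close> at distance
  \<open>\<delta>\<close> and be bounded by \<open>M\<close>. Moving from \<open>y\<close> to the chosen point multiplies \<open>exp (S\<^sub>w \<phi>)\<close>
  by at most \<open>exp \<eta>\<close> for each \<open>None\<close> and \<open>exp (2 M)\<close> for each \<open>Some\<close>. As a pattern that
  occurs has \<open>k < r n\<close> exceptions, \<open>1 \<le> r powr (- r n) * r ^ k\<close>; charging an extra factor \<open>r\<close>
  per exception turns the sum over all patterns into an \<open>n\<close>-th power. The outcome
  (\<open>Q_word_le_Q_word_r\<close>) is
  \<open>Q\<^sub>w (2 \<delta>) \<le> (r powr (- r) * (exp \<eta> + card E * exp (2 M) * r)) ^ n * Q\<^sub>w (\<delta>, r)\<close>.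

  The factor is uniform in \<open>w\<close>, so it survives averaging over words and costs the growth rate
  just its logarithm (\<open>growth_rate_le_add\<close>). With \<open>\<delta>\<close> and \<open>E\<close> fixed, that logarithm tends to
  \<open>\<eta>\<close> as \<open>r \<rightarrow> 0\<close>, and uniform continuity of \<open>\<phi>\<close> makes \<open>\<eta>\<close> as small as desired. The limits
  in the scale are suprema by monotonicity (\<open>tendsto_SUP_at_right\<close>).
\<close>

section \<open>Initial words and their orbits\<close>

lemma initial_words_eq_drop: "initial_words w = (\<lambda>k. drop k w) ` {1..length w}"
proof (intro equalityI subsetI)
  fix v assume "v \<in> initial_words w"
  then obtain u where u: "w = u @ v" "u \<noteq> []"
    by (auto simp: initial_words_def strict_suffix_def suffix_def)
  then show "v \<in> (\<lambda>k. drop k w) ` {1..length w}"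
    by (intro image_eqI[of _ _ "length u"]) (auto simp: Suc_le_eq)
next
  fix v assume "v \<in> (\<lambda>k. drop k w) ` {1..length w}"
  then obtain k where k: "v = drop k w" "1 \<le> k" "k \<le> length w" by auto
  then have "length v < length w" by auto
  then have "v \<noteq> w" by auto
  with k suffix_drop show "v \<in> initial_words w"
    by (auto simp: initial_words_def strict_suffix_def)
qed

lemma finite_initial_words [simp]: "finite (initial_words w)"
  by (simp add: initial_words_eq_drop)

lemma card_initial_words [simp]: "card (initial_words w) = length w"
proof -
  have "inj_on (\<lambda>k. drop k w) {1..length w}"
    by (rule inj_on_inverseI[of _ "\<lambda>v. length w - length v"]) auto
  then show ?thesis
    by (simp add: initial_words_eq_drop card_image)
qed

lemma initial_words_nonempty: "w \<noteq> [] \<Longrightarrow> initial_words w \<noteq> {}"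
  by (metis card_initial_words card.empty length_0_conv)

lemma word_map_initial_in:
  assumes inv: "\<And>i. i < m \<Longrightarrow> f i ` X \<subseteq> X"
    and w: "w \<in> words m n" and v: "v \<in> initial_words w" and x: "x \<in> X"
  shows "word_map f v x \<in> X"
proof -
  have "set v \<subseteq> {..<m}"
    using w v strict_suffix_set_subset[of v w] by (auto simp: words_def initial_words_def)
  then show ?thesis
    by (induction v) (use inv x in \<open>auto simp: word_map_def\<close>)
qed

lemma word_dist_le_iff:
  assumes "w \<noteq> []"
  shows "word_dist f w x y \<le> \<epsilon> \<longleftrightarrow>
    (\<forall>v\<in>initial_words w. dist (word_map f v x) (word_map f v y) \<le> \<epsilon>)"
  using initial_words_nonempty[OF assms] by (auto simp: word_dist_def)

section \<open>Monotonicity in the scale\<close>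

lemma Q_word_antimono: "\<epsilon> \<le> \<epsilon>' \<Longrightarrow> Q_word X f \<phi> \<epsilon>' w \<le> Q_word X f \<phi> \<epsilon> w"
  unfolding Q_word_def
  by (intro INF_superset_mono) (auto simp: spanning_def, meson order_trans)

lemma Q_word_r_antimono:
  assumes "\<epsilon> \<le> \<epsilon>'"
  shows "Q_word_r X f \<phi> \<epsilon>' r w \<le> Q_word_r X f \<phi> \<epsilon> r w"
proof -
  have "r_ball X f y w \<epsilon> r \<subseteq> r_ball X f y w \<epsilon>' r" for y
  proof
    fix x assume x: "x \<in> r_ball X f y w \<epsilon> r"
    have "card {v \<in> initial_words w. dist (word_map f v y) (word_map f v x) < \<epsilon>}
        \<le> card {v \<in> initial_words w. dist (word_map f v y) (word_map f v x) < \<epsilon>'}"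
      by (rule card_mono) (use assms in auto)
    then have "1 / real (length w) * real (card {v \<in> initial_words w. dist (word_map f v y) (word_map f v x) < \<epsilon>})
        \<le> 1 / real (length w) * real (card {v \<in> initial_words w. dist (word_map f v y) (word_map f v x) < \<epsilon>'})"
      by (intro mult_left_mono) auto
    with x show "x \<in> r_ball X f y w \<epsilon>' r"
      by (auto simp: r_ball_def)
  qed
  then show ?thesis
    unfolding Q_word_r_def
    by (intro INF_superset_mono) (auto simp: r_spanning_def, blast)
qed

text \<open>When the orbits stay close throughout, the proportion of good initial words is \<open>1 > 1 - r\<close>.
  The scales differ strictly because \<open>spanning\<close> uses \<open>\<le>\<close> and \<open>r_ball\<close> uses \<open><\<close>.\<close>

lemma Q_word_r_le_Q_word:
  assumes "w \<noteq> []" "0 < r" "\<delta> < \<epsilon>"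
  shows "Q_word_r X f \<phi> \<epsilon> r w \<le> Q_word X f \<phi> \<delta> w"
proof -
  have "r_spanning X f w \<epsilon> r F" if F: "spanning X f w \<delta> F" for F
    unfolding r_spanning_def
  proof (intro conjI ballI)
    show "F \<subseteq> X" using F by (simp add: spanning_def)
    fix x assume x: "x \<in> X"
    then obtain y where y: "y \<in> F" "word_dist f w x y \<le> \<delta>"
      using F by (auto simp: spanning_def)
    then have "{v \<in> initial_words w. dist (word_map f v y) (word_map f v x) < \<epsilon>} = initial_words w"
      using assms by (auto simp: word_dist_le_iff dist_commute intro: le_less_trans)
    then have "x \<in> r_ball X f y w \<epsilon> r"
      using assms x by (simp add: r_ball_def)
    with y show "\<exists>y\<in>F. x \<in> r_ball X f y w \<epsilon> r" by blast
  qed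
  then show ?thesis
    unfolding Q_word_r_def Q_word_def by (intro INF_superset_mono) auto
qed

section \<open>From r-spanning to spanning sets\<close>

text \<open>Distinct points of \<open>F'\<close> select distinct pairs, because the pair determines the point. The
  sum over \<open>F'\<close> is thus dominated by one over \<open>F \<times> H\<close>, which factorises.\<close>

lemma infsum_le_of_selection:
  fixes a :: "'z \<Rightarrow> ennreal" and b :: "'y \<Rightarrow> ennreal" and c :: "'h \<Rightarrow> ennreal"
  assumes "finite H"
    and sel: "\<And>z. z \<in> F' \<Longrightarrow> \<exists>y\<in>F. \<exists>h\<in>H. z = Z y h \<and> a z \<le> c h * b y"
  shows "infsum a F' \<le> (\<Sum>h\<in>H. c h) * infsum b F"
proof -
  have "\<forall>z\<in>F'. \<exists>p. fst p \<in> F \<and> snd p \<in> H \<and> z = Z (fst p) (snd p) \<and> a z \<le> c (snd p) * b (fst p)"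
    using sel by fastforce
  then obtain g where g: "\<And>z. z \<in> F' \<Longrightarrow> fst (g z) \<in> F \<and> snd (g z) \<in> H \<and>
      z = Z (fst (g z)) (snd (g z)) \<and> a z \<le> c (snd (g z)) * b (fst (g z))"
    by (metis (no_types))
  have "sum a G \<le> (\<Sum>h\<in>H. c h) * infsum b F" if G: "finite G" "G \<subseteq> F'" for G
  proof -
    let ?Y = "(\<lambda>z. fst (g z)) ` G"
    have inj: "inj_on g G"
      using g G by (metis inj_onI subsetD)
    have "sum a G \<le> (\<Sum>z\<in>G. c (snd (g z)) * b (fst (g z)))"
      using g G by (intro sum_mono) auto
    also have "\<dots> = (\<Sum>p\<in>g ` G. c (snd p) * b (fst p))"
      by (simp add: sum.reindex[OF inj])
    also have "\<dots> \<le> (\<Sum>p\<in>?Y \<times> H. c (snd p) * b (fst p))"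
    proof (rule sum_mono2)
      show "g ` G \<subseteq> ?Y \<times> H" unfolding image_subset_iff mem_Times_iff using g G by blast
    qed (use G assms in auto)
    also have "\<dots> = (\<Sum>y\<in>?Y. \<Sum>h\<in>H. c h * b y)"
      by (simp add: sum.cartesian_product split_def)
    also have "\<dots> = (\<Sum>h\<in>H. c h) * sum b ?Y"
      by (simp add: sum_product sum.swap[of _ H])
    also have "sum b ?Y \<le> infsum b F"
      by (subst nonneg_infsum_complete) (use g G in \<open>auto intro!: SUP_upper\<close>)
    finally show ?thesis by (simp add: mult_left_mono)
  qed
  then show ?thesis
    by (subst nonneg_infsum_complete) (auto intro: SUP_least)
qed

text \<open>The central estimate: a point of the new spanning set is selected by a point of the old one
  together with a pattern, and the factor is the sum of \<open>c h\<close> over all patterns \<open>h\<close>.\<close>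

lemma Q_word_le_Q_word_r:
  fixes X E :: "'a::metric_space set"
  assumes inv: "\<And>i. i < m \<Longrightarrow> f i ` X \<subseteq> X"
    and w: "w \<in> words m n" and n: "0 < n"
    and r: "0 < r" "r < 1"
    and "finite E" and net: "\<And>x. x \<in> X \<Longrightarrow> \<exists>e\<in>E. dist x e < \<delta>"
    and osc: "\<And>x y. x \<in> X \<Longrightarrow> y \<in> X \<Longrightarrow> dist x y < \<delta> \<Longrightarrow> \<bar>\<phi> x - \<phi> y\<bar> \<le> \<eta>"
    and bound: "\<And>x. x \<in> X \<Longrightarrow> \<bar>\<phi> x\<bar> \<le> M"
  shows "Q_word X f \<phi> (2 * \<delta>) w
    \<le> ennreal ((r powr (- r) * (exp \<eta> + real (card E) * exp (2 * M) * r)) ^ n) * Q_word_r X f \<phi> \<delta> r w"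
proof -
  define I where "I = initial_words w"
  have len: "length w = n" "w \<noteq> []" using w n by (auto simp: words_def)
  have I: "finite I" "card I = n" by (simp_all add: I_def len)
  have orbit: "word_map f v x \<in> X" if "v \<in> I" "x \<in> X" for v x
    using word_map_initial_in[OF inv w] that by (simp add: I_def)
  define H where "H = PiE I (\<lambda>_. insert None (Some ` E))"
  have "finite H" using I \<open>finite E\<close> by (auto simp: H_def intro!: finite_PiE)
  \<comment> \<open>\<open>base\<close> bounds the change of the weight at one initial word; \<open>cost\<close> charges a further \<open>r\<close>
    for an exception, which \<open>c\<close> refunds as long as there are fewer than \<open>r n\<close> of them.\<close>
  define base where "base u = (if u = None then exp \<eta> else exp (2 * M))" for u :: "'a option"
  define cost where "cost u = (if u = None then exp \<eta> else exp (2 * M) * r)" for u :: "'a option"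
  define c where "c h = r powr (- r * n) * (\<Prod>v\<in>I. cost (h v))" for h
  define K where "K = (r powr (- r) * (exp \<eta> + real (card E) * exp (2 * M) * r)) ^ n"
  have "0 < exp \<eta> + real (card E) * exp (2 * M) * r"
    using r by (intro add_pos_nonneg) auto
  then have "0 < K" using r by (simp add: K_def)
  have cost_nonneg: "0 \<le> cost u" for u using r by (simp add: cost_def)
  have sum_c: "(\<Sum>h\<in>H. c h) = K"
  proof -
    have "(\<Sum>h\<in>H. \<Prod>v\<in>I. cost (h v)) = (\<Prod>v\<in>I. \<Sum>u\<in>insert None (Some ` E). cost u)"
      unfolding H_def by (rule prod_sum_PiE[symmetric]) (use I \<open>finite E\<close> in auto)
    also have "(\<Sum>u\<in>insert None (Some ` E). cost u) = exp \<eta> + real (card E) * exp (2 * M) * r"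
      using \<open>finite E\<close> by (subst sum.insert) (auto simp: sum.reindex cost_def)
    finally show ?thesis
      using r by (simp add: c_def K_def I power_mult_distrib powr_powr flip: sum_distrib_left powr_realpow)
  qed
  \<comment> \<open>The points that realise the pattern \<open>h\<close> relative to \<open>y\<close>.\<close>
  define T where "T y h = {z \<in> X. \<forall>v\<in>I. case h v of
      None \<Rightarrow> dist (word_map f v z) (word_map f v y) < \<delta>
    | Some e \<Rightarrow> dist (word_map f v z) e < \<delta>}" for y h
  define Z where "Z y h = (SOME z. z \<in> T y h)" for y h
  define few where "few h \<longleftrightarrow> real (card {v \<in> I. h v \<noteq> None}) < r * n" for h :: "nat list \<Rightarrow> 'a option"
  have "Q_word X f \<phi> (2 * \<delta>) w \<le> ennreal K * weight f \<phi> w F" if F: "r_spanning X f w \<delta> r F" for F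
  proof -
    have FX: "F \<subseteq> X" using F by (simp add: r_spanning_def)
    define F' where "F' = {z. \<exists>y\<in>F. \<exists>h\<in>H. few h \<and> T y h \<noteq> {} \<and> z = Z y h}"
    have Z: "Z y h \<in> T y h" if "T y h \<noteq> {}" for y h
      unfolding Z_def using that by (auto intro: someI)
    have "spanning X f w (2 * \<delta>) F'"
      unfolding spanning_def
    proof (intro conjI ballI)
      show "F' \<subseteq> X" using Z by (fastforce simp: F'_def T_def)
      fix x assume x: "x \<in> X"
      then obtain y where y: "y \<in> F" "x \<in> r_ball X f y w \<delta> r"
        using F by (auto simp: r_spanning_def)
      define near where "near v \<longleftrightarrow> dist (word_map f v y) (word_map f v x) < \<delta>" for v
      have "\<forall>v\<in>I. \<exists>e\<in>E. dist (word_map f v x) e < \<delta>"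
        using net orbit x by blast
      then obtain e where e: "\<And>v. v \<in> I \<Longrightarrow> e v \<in> E \<and> dist (word_map f v x) (e v) < \<delta>"
        by metis
      define h where "h = (\<lambda>v\<in>I. if near v then None else Some (e v))"
      have "h \<in> H" using e by (auto simp: h_def H_def)
      have "real (card {v \<in> I. near v}) > (1 - r) * n"
        using y n by (simp add: r_ball_def near_def I_def len field_simps)
      moreover have "card {v \<in> I. h v \<noteq> None} = card (I - {v \<in> I. near v})"
        by (rule arg_cong[of _ _ card]) (auto simp: h_def)
      moreover have "card (I - {v \<in> I. near v}) = n - card {v \<in> I. near v}"
        using I by (subst card_Diff_subset) auto
      moreover have "card {v \<in> I. near v} \<le> n"
        using I card_mono[of I "{v \<in> I. near v}"] by auto
      ultimately have "few h" by (simp add: few_def algebra_simps of_nat_diff)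
      have xT: "x \<in> T y h"
        using x e by (auto simp: T_def h_def near_def dist_commute)
      then have zT: "Z y h \<in> T y h" using Z by blast
      have "dist (word_map f v x) (word_map f v (Z y h)) \<le> 2 * \<delta>" if v: "v \<in> I" for v
      proof -
        \<comment> \<open>The common reference point \<open>p\<close> is \<open>f\<^sub>v y\<close> or the net point recorded by \<open>h\<close>.\<close>
        obtain p where "dist (word_map f v x) p < \<delta>" "dist (word_map f v (Z y h)) p < \<delta>"
          using xT zT v by (cases "h v") (auto simp: T_def dest!: bspec)
        then show ?thesis
          using dist_triangle2[of "word_map f v x" "word_map f v (Z y h)" p] by linarith
      qed
      then have "word_dist f w x (Z y h) \<le> 2 * \<delta>"
        using len by (simp add: word_dist_le_iff I_def)
      then show "\<exists>z\<in>F'. word_dist f w x z \<le> 2 * \<delta>"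
        using y \<open>h \<in> H\<close> \<open>few h\<close> xT by (auto simp: F'_def)
    qed
    then have "Q_word X f \<phi> (2 * \<delta>) w \<le> weight f \<phi> w F'"
      unfolding Q_word_def by (intro INF_lower) auto
    also have "\<dots> \<le> (\<Sum>h\<in>H. ennreal (c h)) * weight f \<phi> w F"
      unfolding weight_def
    proof (rule infsum_le_of_selection[where Z = Z, OF \<open>finite H\<close>])
      fix z assume "z \<in> F'"
      then obtain y h where yh: "y \<in> F" "h \<in> H" "few h" "z \<in> T y h" "z = Z y h"
        using Z unfolding F'_def by blast
      then have "y \<in> X" "z \<in> X" using FX by (auto simp: T_def)
      let ?k = "card {v \<in> I. h v \<noteq> None}"
      have step: "\<phi> (word_map f v z) \<le> \<phi> (word_map f v y) + ln (base (h v))" if v: "v \<in> I" for v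
      proof (cases "h v")
        case None
        with yh v have "dist (word_map f v z) (word_map f v y) < \<delta>" by (fastforce simp: T_def)
        then show ?thesis
          using osc[of "word_map f v z" "word_map f v y"] orbit v \<open>y \<in> X\<close> \<open>z \<in> X\<close> None
          by (auto simp: base_def)
      next
        case (Some e)
        then show ?thesis
          using bound[of "word_map f v z"] bound[of "word_map f v y"] orbit v \<open>y \<in> X\<close> \<open>z \<in> X\<close>
          by (auto simp: base_def)
      qed
      have "exp (birkhoff_sum f \<phi> w z) = (\<Prod>v\<in>I. exp (\<phi> (word_map f v z)))"
        using I by (simp add: birkhoff_sum_def I_def exp_sum)
      also have "\<dots> \<le> (\<Prod>v\<in>I. exp (\<phi> (word_map f v y)) * base (h v))"
      proof (rule prod_mono)
        fix v assume "v \<in> I"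
        from step[OF this] have "exp (\<phi> (word_map f v z)) \<le> exp (\<phi> (word_map f v y) + ln (base (h v)))"
          by simp
        then show "0 \<le> exp (\<phi> (word_map f v z)) \<and>
            exp (\<phi> (word_map f v z)) \<le> exp (\<phi> (word_map f v y)) * base (h v)"
          by (simp add: exp_add base_def)
      qed
      also have "\<dots> = (\<Prod>v\<in>I. base (h v)) * exp (birkhoff_sum f \<phi> w y)"
        using I by (simp add: birkhoff_sum_def I_def exp_sum prod.distrib mult.commute)
      also have "\<dots> \<le> c h * exp (birkhoff_sum f \<phi> w y)"
      proof (rule mult_right_mono)
        have "(\<Prod>v\<in>I. cost (h v)) = (\<Prod>v\<in>I. base (h v) * (if h v \<noteq> None then r else 1))"
          by (rule prod.cong) (auto simp: cost_def base_def)
        also have "\<dots> = (\<Prod>v\<in>I. base (h v)) * r ^ ?k"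
          using I by (simp add: prod.distrib prod.If_cases Int_def del: not_None_eq)
        finally have cost: "(\<Prod>v\<in>I. cost (h v)) = (\<Prod>v\<in>I. base (h v)) * r ^ ?k" .
        \<comment> \<open>The exponent of \<open>r < 1\<close> drops from \<open>r n\<close> to the number of exceptions.\<close>
        have "1 = r powr (- r * n) * r powr (r * n)"
          using r by (simp flip: powr_add)
        also have "\<dots> \<le> r powr (- r * n) * r powr ?k"
          using r yh by (intro mult_left_mono powr_mono') (auto simp: few_def)
        also have "r powr ?k = r ^ ?k" using r by (simp add: powr_realpow)
        finally have "1 \<le> r powr (- r * n) * r ^ ?k" .
        then have "(\<Prod>v\<in>I. base (h v)) * 1 \<le> (\<Prod>v\<in>I. base (h v)) * (r powr (- r * n) * r ^ ?k)"
          by (intro mult_left_mono prod_nonneg) (auto simp: base_def)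
        then show "(\<Prod>v\<in>I. base (h v)) \<le> c h"
          by (simp add: c_def cost mult_ac)
      qed simp
      finally have "ennreal (exp (birkhoff_sum f \<phi> w z)) \<le> ennreal (c h) * ennreal (exp (birkhoff_sum f \<phi> w y))"
        by (simp add: ennreal_leI flip: ennreal_mult'')
      with yh show "\<exists>y\<in>F. \<exists>h\<in>H. z = Z y h \<and>
          ennreal (exp (birkhoff_sum f \<phi> w z)) \<le> ennreal (c h) * ennreal (exp (birkhoff_sum f \<phi> w y))"
        by blast
    qed
    also have "(\<Sum>h\<in>H. ennreal (c h)) = ennreal K"
      using cost_nonneg by (subst sum_ennreal) (auto simp: c_def sum_c[symmetric] intro!: mult_nonneg_nonneg prod_nonneg)
    finally show ?thesis .
  qed
  \<comment> \<open>Dividing by \<open>K\<close> lets the bound pass to the infimum over \<open>F\<close>.\<close>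
  then have "Q_word X f \<phi> (2 * \<delta>) w / ennreal K \<le> Q_word_r X f \<phi> \<delta> r w"
    unfolding Q_word_r_def using \<open>0 < K\<close> by (intro INF_greatest divide_le_posI_ennreal) auto
  then have "ennreal K * (Q_word X f \<phi> (2 * \<delta>) w / ennreal K) \<le> ennreal K * Q_word_r X f \<phi> \<delta> r w"
    by (rule mult_left_mono) simp
  moreover have "ennreal K * (Q_word X f \<phi> (2 * \<delta>) w / ennreal K) = Q_word X f \<phi> (2 * \<delta>) w"
    using \<open>0 < K\<close> by (simp add: ennreal_times_divide mult.commute[of "ennreal K"] mult_divide_eq_ennreal)
  ultimately show ?thesis by (simp add: K_def)
qed

section \<open>Exponential growth rates\<close>

definition growth_rate :: "(nat \<Rightarrow> ennreal) \<Rightarrow> ereal" where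
  "growth_rate q = limsup (\<lambda>n. ereal (1 / real n) * ext_ln (q n))"

lemma ext_ln_mono: "p \<le> q \<Longrightarrow> ext_ln p \<le> ext_ln q"
  by (cases p; cases q) (auto simp: ext_ln_def top_unique)

lemma ext_ln_mult: "0 < c \<Longrightarrow> ext_ln (ennreal c * q) = ereal (ln c) + ext_ln q"
  by (cases q) (auto simp: ext_ln_def ennreal_mult_top ln_mult simp flip: ennreal_mult'')

text \<open>Valid also for infinite growth rates: only the finite constant \<open>ln C\<close> is moved out of the
  upper limit.\<close>

lemma growth_rate_le_add:
  assumes "0 < C" and le: "\<And>n. 0 < n \<Longrightarrow> p n \<le> ennreal (C ^ n) * q n"
  shows "growth_rate p \<le> growth_rate q + ereal (ln C)"
proof -
  have "ereal (1 / real n) * ext_ln (p n) \<le> ereal (1 / real n) * ext_ln (q n) + ereal (ln C)"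
    if n: "0 < n" for n
  proof -
    have "ext_ln (p n) \<le> ereal (n * ln C) + ext_ln (q n)"
      using ext_ln_mono[OF le[OF n]] assms(1) by (simp add: ext_ln_mult ln_realpow)
    then have "ereal (1 / real n) * ext_ln (p n) \<le> ereal (1 / real n) * (ereal (n * ln C) + ext_ln (q n))"
      by (intro ereal_mult_left_mono) auto
    also have "\<dots> = ereal (1 / real n) * ext_ln (q n) + ereal (ln C)"
      using n by (cases "ext_ln (q n)") (auto simp: field_simps)
    finally show ?thesis .
  qed
  then have "growth_rate p \<le> limsup (\<lambda>n. ereal (1 / real n) * ext_ln (q n) + ereal (ln C))"
    unfolding growth_rate_def
    by (intro Limsup_mono) (auto intro: eventually_mono[OF eventually_gt_at_top[of 0]])
  then show ?thesis
    by (simp add: growth_rate_def Limsup_add_ereal_right)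
qed

lemma growth_rate_mono: "(\<And>n. 0 < n \<Longrightarrow> p n \<le> q n) \<Longrightarrow> growth_rate p \<le> growth_rate q"
  using growth_rate_le_add[of 1 p q] by simp

lemma word_average_le:
  assumes "\<And>w. w \<in> words m n \<Longrightarrow> P w \<le> c * Q w"
  shows "(\<Sum>w\<in>words m n. P w) / of_nat (m ^ n) \<le> (c::ennreal) * ((\<Sum>w\<in>words m n. Q w) / of_nat (m ^ n))"
proof -
  have "(\<Sum>w\<in>words m n. P w) \<le> c * (\<Sum>w\<in>words m n. Q w)"
    using sum_mono[OF assms] by (simp add: sum_distrib_left)
  then show ?thesis
    unfolding ennreal_times_divide by (rule divide_right_mono_ennreal)
qed

lemma tendsto_SUP_at_right:
  fixes g :: "real \<Rightarrow> 'b::{complete_linorder, linorder_topology}"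
  assumes anti: "\<And>s t. 0 < s \<Longrightarrow> s \<le> t \<Longrightarrow> g t \<le> g s"
  shows "(g \<longlongrightarrow> (SUP t\<in>{0<..}. g t)) (at_right 0)"
proof (rule order_tendstoI)
  fix a assume "a < (SUP t\<in>{0<..}. g t)"
  then obtain t where t: "0 < t" "a < g t" by (auto simp: less_SUP_iff)
  show "\<forall>\<^sub>F s in at_right 0. a < g s"
    using t(1) unfolding eventually_at_right_field by (intro exI[of _ t]) (auto intro!: less_le_trans[OF t(2)] anti)
next
  fix a assume "(SUP t\<in>{0<..}. g t) < a"
  then show "\<forall>\<^sub>F s in at_right 0. g s < a"
    by (intro eventually_mono[OF eventually_at_right_less])
       (auto intro: le_less_trans[OF SUP_upper])
qed

section \<open>Pressure and r-pressure\<close>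

lemma pressure_eq_SUP: "pressure X m f \<phi> = (SUP \<epsilon>\<in>{0<..}. growth_rate (Q_avg X m f \<phi> \<epsilon>))"
proof -
  have "Q_avg X m f \<phi> \<epsilon>' n \<le> Q_avg X m f \<phi> \<epsilon> n" if "\<epsilon> \<le> \<epsilon>'" for \<epsilon> \<epsilon>' n
    unfolding Q_avg_def by (intro divide_right_mono_ennreal sum_mono Q_word_antimono that)
  then have "((\<lambda>\<epsilon>. growth_rate (Q_avg X m f \<phi> \<epsilon>)) \<longlongrightarrow> (SUP \<epsilon>\<in>{0<..}. growth_rate (Q_avg X m f \<phi> \<epsilon>))) (at_right 0)"
    by (intro tendsto_SUP_at_right growth_rate_mono)
  then show ?thesis
    unfolding pressure_def growth_rate_def by (intro tendsto_Lim) auto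
qed

lemma r_pressure_eq_SUP:
  "r_pressure X m f \<phi> r = (SUP \<epsilon>\<in>{0<..}. growth_rate (Q_avg_r X m f \<phi> \<epsilon> r))"
proof -
  have "Q_avg_r X m f \<phi> \<epsilon>' r n \<le> Q_avg_r X m f \<phi> \<epsilon> r n" if "\<epsilon> \<le> \<epsilon>'" for \<epsilon> \<epsilon>' n
    unfolding Q_avg_r_def by (intro divide_right_mono_ennreal sum_mono Q_word_r_antimono that)
  then have "((\<lambda>\<epsilon>. growth_rate (Q_avg_r X m f \<phi> \<epsilon> r)) \<longlongrightarrow> (SUP \<epsilon>\<in>{0<..}. growth_rate (Q_avg_r X m f \<phi> \<epsilon> r))) (at_right 0)"
    by (intro tendsto_SUP_at_right growth_rate_mono)
  then show ?thesis
    unfolding r_pressure_def growth_rate_def by (intro tendsto_Lim) auto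
qed

lemma r_pressure_le_pressure:
  assumes "0 < r"
  shows "r_pressure X m f \<phi> r \<le> pressure X m f \<phi>"
  unfolding r_pressure_eq_SUP
proof (rule SUP_least)
  fix \<epsilon> :: real assume \<epsilon>: "\<epsilon> \<in> {0<..}"
  have "Q_avg_r X m f \<phi> \<epsilon> r n \<le> Q_avg X m f \<phi> (\<epsilon> / 2) n" if "0 < n" for n
    unfolding Q_avg_r_def Q_avg_def
    by (intro divide_right_mono_ennreal sum_mono Q_word_r_le_Q_word)
       (use \<epsilon> that assms in \<open>auto simp: words_def\<close>)
  then have "growth_rate (Q_avg_r X m f \<phi> \<epsilon> r) \<le> growth_rate (Q_avg X m f \<phi> (\<epsilon> / 2))"
    by (rule growth_rate_mono)
  also have "\<dots> \<le> pressure X m f \<phi>"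
    unfolding pressure_eq_SUP using \<epsilon> by (intro SUP_upper) auto
  finally show "growth_rate (Q_avg_r X m f \<phi> \<epsilon> r) \<le> pressure X m f \<phi>" .
qed

lemma growth_rate_Q_avg_le_r_pressure:
  fixes X E :: "'a::metric_space set"
  assumes "\<And>i. i < m \<Longrightarrow> f i ` X \<subseteq> X"
    and r: "0 < r" "r < 1" and "0 < \<delta>"
    and "finite E" and "\<And>x. x \<in> X \<Longrightarrow> \<exists>e\<in>E. dist x e < \<delta>"
    and "\<And>x y. x \<in> X \<Longrightarrow> y \<in> X \<Longrightarrow> dist x y < \<delta> \<Longrightarrow> \<bar>\<phi> x - \<phi> y\<bar> \<le> \<eta>"
    and "\<And>x. x \<in> X \<Longrightarrow> \<bar>\<phi> x\<bar> \<le> M"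
  shows "growth_rate (Q_avg X m f \<phi> (2 * \<delta>))
    \<le> r_pressure X m f \<phi> r + ereal (ln (r powr (- r) * (exp \<eta> + real (card E) * exp (2 * M) * r)))"
proof -
  have "0 < exp \<eta> + real (card E) * exp (2 * M) * r"
    using r by (intro add_pos_nonneg) auto
  then have "growth_rate (Q_avg X m f \<phi> (2 * \<delta>)) \<le> growth_rate (Q_avg_r X m f \<phi> \<delta> r)
      + ereal (ln (r powr (- r) * (exp \<eta> + real (card E) * exp (2 * M) * r)))"
    unfolding Q_avg_def Q_avg_r_def
    by (intro growth_rate_le_add word_average_le Q_word_le_Q_word_r) (use assms in auto)
  also have "growth_rate (Q_avg_r X m f \<phi> \<delta> r) \<le> r_pressure X m f \<phi> r"
    unfolding r_pressure_eq_SUP using \<open>0 < \<delta>\<close> by (intro SUP_upper) auto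
  finally show ?thesis by (simp add: add_right_mono)
qed

theorem theorem1p4:
  fixes X :: "'a::metric_space set"
    and m :: nat
    and f :: "nat \<Rightarrow> 'a \<Rightarrow> 'a"
    and \<phi> :: "'a \<Rightarrow> real"
  assumes "compact X"
    and "m \<ge> 1"
    and "\<And>i. i < m \<Longrightarrow> continuous_on X (f i)"
    and "\<And>i. i < m \<Longrightarrow> f i ` X \<subseteq> X"
    and "continuous_on X \<phi>"
  shows "((\<lambda>r. r_pressure X m f \<phi> r) \<longlongrightarrow> pressure X m f \<phi>) (at_right 0)"
proof (rule order_tendstoI)
  fix a assume "pressure X m f \<phi> < a"
  then show "\<forall>\<^sub>F r in at_right 0. r_pressure X m f \<phi> r < a"
    by (intro eventually_mono[OF eventually_at_right_less])
       (auto intro: le_less_trans[OF r_pressure_le_pressure])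
next
  fix a assume "a < pressure X m f \<phi>"
  then obtain \<epsilon> where \<epsilon>: "0 < \<epsilon>" "a < growth_rate (Q_avg X m f \<phi> \<epsilon>)"
    by (auto simp: pressure_eq_SUP less_SUP_iff)
  \<comment> \<open>Two real numbers in between: \<open>a\<close> may be \<open>- \<infinity>\<close> and the growth rate \<open>\<infinity>\<close>, and the gap
    \<open>b' - b\<close> must absorb an error that stays below \<open>2 \<eta>\<close>.\<close>
  obtain b where b: "a < ereal b" "ereal b < growth_rate (Q_avg X m f \<phi> \<epsilon>)"
    using ereal_dense2[OF \<epsilon>(2)] by blast
  obtain b' where b': "ereal b < ereal b'" "ereal b' < growth_rate (Q_avg X m f \<phi> \<epsilon>)"
    using ereal_dense2[OF b(2)] by blast
  define \<eta> where "\<eta> = (b' - b) / 2"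
  have "0 < \<eta>" using b' by (simp add: \<eta>_def)
  have "uniformly_continuous_on X \<phi>"
    by (intro compact_uniformly_continuous assms)
  then obtain \<delta>0 where \<delta>0: "0 < \<delta>0"
      "\<And>x y. x \<in> X \<Longrightarrow> y \<in> X \<Longrightarrow> dist x y < \<delta>0 \<Longrightarrow> \<bar>\<phi> x - \<phi> y\<bar> < \<eta>"
    unfolding uniformly_continuous_on_def dist_real_def using \<open>0 < \<eta>\<close> by metis
  define \<delta> where "\<delta> = min \<delta>0 (\<epsilon> / 2)"
  have "0 < \<delta>" "\<delta> \<le> \<delta>0" "2 * \<delta> \<le> \<epsilon>" using \<epsilon> \<delta>0 by (auto simp: \<delta>_def)
  obtain M where M: "\<And>x. x \<in> X \<Longrightarrow> \<bar>\<phi> x\<bar> \<le> M"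
    using compact_imp_bounded[OF compact_continuous_image[OF assms(5,1)]]
    by (auto simp: bounded_iff)
  obtain E where E: "finite E" "X \<subseteq> (\<Union>e\<in>E. ball e \<delta>)"
    using compactE_image[OF assms(1), of X "\<lambda>e. ball e \<delta>"] \<open>0 < \<delta>\<close> by (metis UN_I centre_in_ball open_ball subsetI)
  then have net: "\<exists>e\<in>E. dist x e < \<delta>" if "x \<in> X" for x
    using that by (fastforce simp: dist_commute)
  define L where "L r = ln (r powr (- r) * (exp \<eta> + real (card E) * exp (2 * M) * r))" for r
  have "(L \<longlongrightarrow> \<eta>) (at_right 0)"
    unfolding L_def by real_asymp
  then have "\<forall>\<^sub>F r in at_right 0. L r < 2 * \<eta>"
    using \<open>0 < \<eta>\<close> by (intro order_tendstoD) auto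
  moreover have "\<forall>\<^sub>F r::real in at_right 0. 0 < r \<and> r < 1"
    by (auto simp: eventually_at_right_field intro: exI[of _ 1])
  ultimately show "\<forall>\<^sub>F r in at_right 0. a < r_pressure X m f \<phi> r"
  proof eventually_elim
    case (elim r)
    have "ereal b' < growth_rate (Q_avg X m f \<phi> \<epsilon>)" by (fact b')
    also have "\<dots> \<le> growth_rate (Q_avg X m f \<phi> (2 * \<delta>))"
      unfolding Q_avg_def using \<open>2 * \<delta> \<le> \<epsilon>\<close>
      by (intro growth_rate_mono divide_right_mono_ennreal sum_mono Q_word_antimono)
    also have "\<dots> \<le> r_pressure X m f \<phi> r + ereal (L r)"
      unfolding L_def
    proof (rule growth_rate_Q_avg_le_r_pressure)
      show "\<bar>\<phi> x - \<phi> y\<bar> \<le> \<eta>" if "x \<in> X" "y \<in> X" "dist x y < \<delta>" for x y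
        using \<delta>0(2)[OF that(1,2)] that(3) \<open>\<delta> \<le> \<delta>0\<close> by linarith
    qed (use elim assms E net M \<open>0 < \<delta>\<close> in auto)
    finally have "ereal (b' - L r) < r_pressure X m f \<phi> r"
      by (cases "r_pressure X m f \<phi> r") auto
    moreover have "b \<le> b' - L r" using elim by (simp add: \<eta>_def)
    ultimately show ?case
      using b(1) by (meson ereal_less_eq(3) le_less_trans less_le_trans less_trans)
  qed
qed

end
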